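(* Let $k$ be a field and $n\ge3$. Then $\mathcal C^n_2[k]$ is the set of bonds of the complete graph $K_n$ on $[n]=\{1,\dots,n\}$. That is, $\mathcal C^n_2[k]$ is the set of all $E(A,B)$ for $A,B$ a partition of $[n]$ into two nonempty parts, where $E(A,B)$ is the set of all edges (two-element subsets of $[n]$) with one vertex in $A$ and the other in $B$.
   Context: Let $\binom{[n]}{p}$ be the set of $p$-element subsets of $[n]$. For $1\le p<n$ let $M(n,p)$ be the matrix over $k$ with rows indexed by $\binom{[n]}{p}$ and columns indexed by $\binom{[n]}{p+1}$, with $(\sigma,\tau)$ entry equal to $0$ if $\sigma\not\subset\tau$ and, if $\sigma\subset\tau$ with $\tau\setminus\sigma=\{j\}$, equal to $(-1)^{\#\{s\in\tau:\,s<j\}}$. $\mathcal C^n_p[k]$ is the collection of all $C\subset\binom{[n]}{p}$ such that the rows of $M(n,p)$ indexed by $C$ form a minimal linearly dependent set over $k$. A bond of a graph is a minimal set of edges whose deletion disconnects the graph. *)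

theory Defs
  imports Main "HOL-Library.Ramsey"
begin

definition M_entry :: "nat set \<Rightarrow> nat set \<Rightarrow> 'k::field"
  where "M_entry \<sigma> \<tau> =
    (if \<sigma> \<subset> \<tau> then (- 1) ^ card {s \<in> \<tau>. s < the_elem (\<tau> - \<sigma>)} else 0)"

text \<open>Linear dependence is that of the family of rows indexed by the elements of \<open>C\<close>, not of the set
  of row vectors: distinct indices may carry equal rows (for instance \<open>{1,2}\<close> and \<open>{2,3}\<close> when
  \<open>n = 3\<close>, \<open>p = 2\<close>), and these count as dependent.\<close>

definition rows_dependent :: "'k::field itself \<Rightarrow> nat \<Rightarrow> nat \<Rightarrow> nat set set \<Rightarrow> bool"
  where "rows_dependent _ n p C \<longleftrightarrow>
    (\<exists>c :: nat set \<Rightarrow> 'k. (\<exists>\<sigma>\<in>C. c \<sigma> \<noteq> 0) \<and>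
       (\<forall>\<tau> \<in> nsets {1..n} (p + 1). (\<Sum>\<sigma>\<in>C. c \<sigma> * M_entry \<sigma> \<tau>) = 0))"

definition circuits :: "'k::field itself \<Rightarrow> nat \<Rightarrow> nat \<Rightarrow> nat set set set"
  where "circuits k n p =
    {C. C \<subseteq> nsets {1..n} p \<and> rows_dependent k n p C \<and> (\<forall>D. D \<subset> C \<longrightarrow> \<not> rows_dependent k n p D)}"

text \<open>A simple graph is given by its vertex set \<open>V\<close> and its set \<open>E\<close> of two-element edges.\<close>

definition graph_connected :: "'a set \<Rightarrow> 'a set set \<Rightarrow> bool"
  where "graph_connected V E \<longleftrightarrow> (\<forall>u\<in>V. \<forall>v\<in>V. (u, v) \<in> {(x, y). {x, y} \<in> E}\<^sup>*)"

text \<open>The following is meant for connected graphs, where disconnecting the graph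
  means that the remaining graph is not connected.\<close>

definition bonds :: "'a set \<Rightarrow> 'a set set \<Rightarrow> 'a set set set"
  where "bonds V E =
    {F. F \<subseteq> E \<and> \<not> graph_connected V (E - F) \<and> (\<forall>F'. F' \<subset> F \<longrightarrow> graph_connected V (E - F'))}"

definition cut_edges :: "'a set \<Rightarrow> 'a set \<Rightarrow> 'a set set"
  where "cut_edges A B = {e. card e = 2 \<and> (\<exists>a\<in>A. \<exists>b\<in>B. e = {a, b})}"

end

theory Submission
  imports Defs
begin

text \<open>The row relations of \<open>M(n,2)\<close> are the 1-cocycles of the full simplex on \<open>[n]\<close>, that is, the
  functions \<open>{i,j} \<mapsto> f j - f i\<close> (\<open>i < j\<close>) for \<open>f : [n] \<rightarrow> k\<close>. Hence the rows in \<open>C\<close> are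
  dependent iff some nonconstant \<open>f\<close> is constant along every edge outside \<open>C\<close>, which says
  precisely that deleting \<open>C\<close> disconnects \<open>K\<^sub>n\<close>.\<close>

lemma pair_in_nsets_2_iff: "{x, y} \<in> nsets V 2 \<longleftrightarrow> x \<in> V \<and> y \<in> V \<and> x \<noteq> y"
  by (auto simp: nsets_def card_2_iff doubleton_eq_iff)

lemma ordered_pairE:
  assumes "e \<in> nsets V 2"
  obtains x y :: "'a::linorder" where "x \<in> V" "y \<in> V" "x < y" "e = {x, y}"
proof -
  obtain x y where "e = {x, y}" "x \<noteq> y"
    using assms by (auto simp: nsets_def card_2_iff)
  with assms that show thesis
    by (metis insert_commute linorder_neqE pair_in_nsets_2_iff)
qed

lemma ordered_tripleE:
  assumes "t \<in> nsets V 3"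
  obtains x y z :: "'a::linorder"
  where "x \<in> V" "y \<in> V" "z \<in> V" "x < y" "y < z" "t = {x, y, z}"
proof -
  obtain a b c where t: "t = {a, b, c}" "a \<noteq> b" "b \<noteq> c" "a \<noteq> c" "a \<in> V" "b \<in> V" "c \<in> V"
    using assms by (auto simp: nsets_def card_3_iff)
  have perm: "{a, b, c} = {a, c, b}" "{a, b, c} = {b, a, c}" "{a, b, c} = {b, c, a}"
    "{a, b, c} = {c, a, b}" "{a, b, c} = {c, b, a}"
    by auto
  consider "a < b" "b < c" | "a < c" "c < b" | "b < a" "a < c"
    | "b < c" "c < a" | "c < a" "a < b" | "c < b" "b < a"
    using t(2-4) by (metis linorder_neqE)
  then show thesis
    by cases (use that t(1,5-7) perm in metis)+
qed

lemma triple_in_nsets_3: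
  fixes x y z :: "'a::linorder"
  assumes "x \<in> V" "y \<in> V" "z \<in> V" "x < y" "y < z"
  shows "{x, y, z} \<in> nsets V 3"
proof -
  have "x \<noteq> y" "x \<noteq> z" "y \<noteq> z"
    using assms(4,5) by auto
  with assms(1-3) show ?thesis
    by (simp add: nsets_def)
qed

text \<open>The sign exponent counts the vertices of the triangle below the omitted one: 0, 1 and 2
  of them when \<open>x\<close>, \<open>y\<close> and \<open>z\<close> are omitted. These are the
  signs of the simplicial coboundary.\<close>

lemma M_entry_triple:
  assumes "x < y" "y < z"
  shows "M_entry {y, z} {x, y, z} = (1::'k::field)"
    and "M_entry {x, z} {x, y, z} = (- 1::'k)"
    and "M_entry {x, y} {x, y, z} = (1::'k)"
proof -
  have ne: "x \<noteq> y" "x \<noteq> z" "y \<noteq> z" "y \<noteq> x" "z \<noteq> x" "z \<noteq> y"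
    using assms by auto
  have "{x, y, z} - {y, z} = {x}" "{x, y, z} - {x, z} = {y}" "{x, y, z} - {x, y} = {z}"
    "{s \<in> {x, y, z}. s < x} = {}" "{s \<in> {x, y, z}. s < y} = {x}" "{s \<in> {x, y, z}. s < z} = {x, y}"
    using assms by auto
  moreover have "{y, z} \<subset> {x, y, z}" "{x, z} \<subset> {x, y, z}" "{x, y} \<subset> {x, y, z}"
    using ne by auto
  ultimately show "M_entry {y, z} {x, y, z} = (1::'k)" "M_entry {x, z} {x, y, z} = (- 1::'k)"
    "M_entry {x, y} {x, y, z} = (1::'k)"
    using ne by (simp_all only: M_entry_def if_True the_elem_eq) simp_all
qed

text \<open>Since \<open>c\<close> vanishes on the edges outside \<open>C\<close>, the sum extends
  to all edges. The column of a triangle is supported on its three sides, so the relation at that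
  column becomes a cocycle identity that no longer mentions \<open>C\<close>.\<close>

lemma sum_M_entry_triple:
  fixes c :: "nat set \<Rightarrow> 'k::field"
  assumes xyz: "x < y" "y < z" and V: "x \<in> V" "y \<in> V" "z \<in> V" "finite V"
    and C: "C \<subseteq> nsets V 2"
    and c: "\<And>e. e \<in> nsets V 2 - C \<Longrightarrow> c e = 0"
  shows "(\<Sum>\<sigma>\<in>C. c \<sigma> * M_entry \<sigma> {x, y, z}) = c {y, z} - c {x, z} + c {x, y}"
proof -
  have "(\<Sum>\<sigma>\<in>C. c \<sigma> * M_entry \<sigma> {x, y, z}) = (\<Sum>\<sigma>\<in>nsets V 2. c \<sigma> * M_entry \<sigma> {x, y, z})"
    by (rule sum.mono_neutral_left) (use C c V in \<open>auto simp: finite_imp_finite_nsets\<close>)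
  also have "\<dots> = (\<Sum>\<sigma>\<in>{{y, z}, {x, z}, {x, y}}. c \<sigma> * M_entry \<sigma> {x, y, z})"
  proof (rule sum.mono_neutral_right)
    show "\<forall>\<sigma>\<in>nsets V 2 - {{y, z}, {x, z}, {x, y}}. c \<sigma> * M_entry \<sigma> {x, y, z} = 0"
    proof
      \<comment> \<open>An edge contained in the triangle must be one of its three sides.\<close>
      fix \<sigma> assume \<sigma>: "\<sigma> \<in> nsets V 2 - {{y, z}, {x, z}, {x, y}}"
      then obtain a b where "\<sigma> = {a, b}" "a < b"
        by (metis DiffD1 ordered_pairE)
      with \<sigma> xyz have "\<not> \<sigma> \<subset> {x, y, z}"
        by auto
      then show "c \<sigma> * M_entry \<sigma> {x, y, z} = 0"
        by (simp add: M_entry_def)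
    qed
  qed (use V xyz in \<open>auto simp: finite_imp_finite_nsets pair_in_nsets_2_iff\<close>)
  also have "\<dots> = c {y, z} - c {x, z} + c {x, y}"
    using xyz by (simp add: M_entry_triple doubleton_eq_iff)
  finally show ?thesis .
qed

lemma rows_dependent_2_iff:
  assumes C: "C \<subseteq> nsets {1..n} 2"
  shows "rows_dependent TYPE('k::field) n 2 C \<longleftrightarrow>
    (\<exists>c :: nat set \<Rightarrow> 'k. (\<exists>e\<in>C. c e \<noteq> 0) \<and> (\<forall>e \<in> nsets {1..n} 2 - C. c e = 0) \<and>
      (\<forall>x\<in>{1..n}. \<forall>y\<in>{1..n}. \<forall>z\<in>{1..n}. x < y \<longrightarrow> y < z \<longrightarrow> c {y, z} - c {x, z} + c {x, y} = 0))"
    (is "_ \<longleftrightarrow> (\<exists>c. ?P c)")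
proof
  assume "rows_dependent TYPE('k) n 2 C"
  then obtain c :: "nat set \<Rightarrow> 'k" where c: "\<exists>e\<in>C. c e \<noteq> 0"
    "\<And>t. t \<in> nsets {1..n} 3 \<Longrightarrow> (\<Sum>\<sigma>\<in>C. c \<sigma> * M_entry \<sigma> t) = 0"
    by (auto simp: rows_dependent_def)
  \<comment> \<open>The dependence says nothing about \<open>c\<close> outside \<open>C\<close>;
    resetting it to 0 there leaves the sums over \<open>C\<close> unchanged.\<close>
  define d where "d e = (if e \<in> C then c e else 0)" for e
  have "d {y, z} - d {x, z} + d {x, y} = 0"
    if "x \<in> {1..n}" "y \<in> {1..n}" "z \<in> {1..n}" "x < y" "y < z" for x y z
  proof -
    have "d {y, z} - d {x, z} + d {x, y} = (\<Sum>\<sigma>\<in>C. d \<sigma> * M_entry \<sigma> {x, y, z})"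
      using that C by (intro sum_M_entry_triple[symmetric]) (auto simp: d_def)
    also have "\<dots> = (\<Sum>\<sigma>\<in>C. c \<sigma> * M_entry \<sigma> {x, y, z})"
      by (intro sum.cong) (auto simp: d_def)
    also have "\<dots> = 0"
      using that by (intro c(2) triple_in_nsets_3)
    finally show ?thesis .
  qed
  with c(1) have "?P d"
    by (auto simp: d_def)
  then show "\<exists>c. ?P c"
    by (rule exI[where x = d])
next
  assume "\<exists>c. ?P c"
  then obtain c where c: "?P c" ..
  have "(\<Sum>\<sigma>\<in>C. c \<sigma> * M_entry \<sigma> t) = 0" if "t \<in> nsets {1..n} 3" for t
    using that
  proof (rule ordered_tripleE)
    fix x y z assume "x \<in> {1..n}" "y \<in> {1..n}" "z \<in> {1..n}" "x < y" "y < z" "t = {x, y, z}"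
    with c C show ?thesis
      by (subst \<open>t = _\<close>, subst sum_M_entry_triple[where V = "{1..n}"]) auto
  qed
  with c show "rows_dependent TYPE('k) n 2 C"
    by (auto simp: rows_dependent_def)
qed

text \<open>Serves to certify disconnection: a function that is constant along edges but differs at
  two vertices separates them.\<close>

lemma rtrancl_edges_invariant:
  assumes "(u, v) \<in> {(x, y). {x, y} \<in> E}\<^sup>*"
    and "\<And>x y. {x, y} \<in> E \<Longrightarrow> f x = f y"
  shows "f u = f v"
  using assms(1) by (induction rule: rtrancl_induct) (use assms(2) in auto)

lemma rows_dependent_2_iff_not_connected:
  assumes C: "C \<subseteq> nsets {1..n} 2"
  shows "rows_dependent TYPE('k::field) n 2 C \<longleftrightarrow> \<not> graph_connected {1..n} (nsets {1..n} 2 - C)"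
    (is "_ \<longleftrightarrow> \<not> graph_connected ?V ?E")
proof
  assume "rows_dependent TYPE('k) n 2 C"
  then obtain c :: "nat set \<Rightarrow> 'k" where nz: "\<exists>e\<in>C. c e \<noteq> 0" and z: "\<forall>e\<in>?E. c e = 0"
    and cocycle: "\<And>x y z. x \<in> ?V \<Longrightarrow> y \<in> ?V \<Longrightarrow> z \<in> ?V \<Longrightarrow> x < y \<Longrightarrow> y < z \<Longrightarrow>
      c {y, z} - c {x, z} + c {x, y} = 0"
    unfolding rows_dependent_2_iff[OF C] by blast
  \<comment> \<open>A potential for \<open>c\<close>, normalised to 0 at the smallest vertex. The
    case \<open>i = 1\<close> is separate because \<open>{1, 1}\<close> is a singleton, where
    \<open>c\<close> is unconstrained. The triangle \<open>1 < x < y\<close> then expresses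
    \<open>c {x, y}\<close> as a difference of \<open>f\<close>.\<close>
  define f where "f i = (if i = 1 then 0 else c {1, i})" for i
  have c_eq: "c {x, y} = f y - f x" if "x \<in> ?V" "y \<in> ?V" "x < y" for x y
    using cocycle[of 1 x y] that by (cases "x = 1") (auto simp: f_def algebra_simps)
  have inv: "f x = f y" if "{x, y} \<in> ?E" for x y
  proof -
    have "c {x, y} = 0" "x \<in> ?V" "y \<in> ?V" "x \<noteq> y"
      using that z by (auto simp: pair_in_nsets_2_iff)
    then show ?thesis
      using c_eq by (metis eq_iff_diff_eq_0 insert_commute linorder_neqE_nat)
  qed
  obtain x y where "x \<in> ?V" "y \<in> ?V" "x < y" "c {x, y} \<noteq> 0"
    using nz C by (metis ordered_pairE subsetD)
  then have "f x \<noteq> f y"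
    using c_eq by auto
  then have "(x, y) \<notin> {(x, y). {x, y} \<in> ?E}\<^sup>*"
    using rtrancl_edges_invariant[of x y ?E f] inv by blast
  then show "\<not> graph_connected ?V ?E"
    using \<open>x \<in> ?V\<close> \<open>y \<in> ?V\<close> unfolding graph_connected_def by blast
next
  let ?R = "{(x, y). {x, y} \<in> ?E}"
  assume "\<not> graph_connected ?V ?E"
  then obtain u v where uv: "u \<in> ?V" "v \<in> ?V" "(u, v) \<notin> ?R\<^sup>*"
    by (auto simp: graph_connected_def)
  \<comment> \<open>The indicator of the component of \<open>u\<close>; its values 0 and 1 differ in
    every field.\<close>
  define f :: "nat \<Rightarrow> 'k" where "f i = (if (u, i) \<in> ?R\<^sup>* then 1 else 0)" for i
  \<comment> \<open>\<open>Min\<close> and \<open>Max\<close> orient each edge from its smaller to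
    its larger end. As differences of \<open>f\<close>, the values of \<open>c\<close> satisfy every
    triangle identity by cancellation.\<close>
  define c where "c e = f (Max e) - f (Min e)" for e
  have c_eq: "c {x, y} = f y - f x" if "x < y" for x y
    using that by (simp add: c_def)
  have "f x = f y" if "{x, y} \<in> ?E" for x y
  proof -
    have "(x, y) \<in> ?R" "(y, x) \<in> ?R"
      using that by (auto simp: insert_commute)
    then show ?thesis
      unfolding f_def by (meson rtrancl.rtrancl_into_rtrancl)
  qed
  then have z: "c e = 0" if "e \<in> ?E" for e
    using that c_eq by (metis DiffD1 ordered_pairE right_minus_eq)
  have "u \<noteq> v" "f u \<noteq> f v"
    using uv by (auto simp: f_def)
  then have "c {u, v} \<noteq> 0"
    using c_eq[of u v] c_eq[of v u] by (cases "u < v") (simp_all add: insert_commute[of u v])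
  moreover from this have "{u, v} \<in> C"
    using z uv \<open>u \<noteq> v\<close> by (auto simp: pair_in_nsets_2_iff)
  ultimately show "rows_dependent TYPE('k) n 2 C"
    unfolding rows_dependent_2_iff[OF C]
    by (intro exI[of _ c]) (use z in \<open>auto simp: c_eq\<close>)
qed

text \<open>Dependence and disconnection agree on every set of edges, hence also on all subsets of
  \<open>C\<close>, so the minimal sets for the two properties coincide.\<close>

lemma circuits_2_eq_bonds:
  "circuits TYPE('k::field) n 2 = bonds {1..n} (nsets {1..n} 2)"
  unfolding circuits_def bonds_def
  by (intro Collect_cong) (metis psubset_imp_subset rows_dependent_2_iff_not_connected subset_trans)

text \<open>The surviving edges lie inside \<open>A\<close> or inside \<open>B\<close>, so
  membership in \<open>A\<close> is constant along them and separates the two sides.\<close>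

lemma not_connected_minus_cut_edges:
  assumes "A \<union> B = V" "A \<inter> B = {}" "A \<noteq> {}" "B \<noteq> {}"
  shows "\<not> graph_connected V (nsets V 2 - cut_edges A B)"
proof -
  obtain a b where ab: "a \<in> A" "b \<in> B"
    using assms by auto
  have "(x \<in> A) = (y \<in> A)" if "{x, y} \<in> nsets V 2 - cut_edges A B" for x y
  proof -
    have "x \<in> V" "y \<in> V" "x \<noteq> y" "{x, y} \<notin> cut_edges A B" "{y, x} \<notin> cut_edges A B"
      using that by (auto simp: pair_in_nsets_2_iff insert_commute)
    then show ?thesis
      using assms(1) by (auto simp: cut_edges_def)
  qed
  from rtrancl_edges_invariant[of a b "nsets V 2 - cut_edges A B" "\<lambda>x. x \<in> A", OF _ this]
  have "(a, b) \<notin> {(x, y). {x, y} \<in> nsets V 2 - cut_edges A B}\<^sup>*"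
    using ab assms(2) by blast
  with ab assms(1) show ?thesis
    unfolding graph_connected_def by blast
qed

text \<open>Some cut edge \<open>{a, b}\<close> survives, and so do all edges inside either part.
  Thus \<open>a\<close> is joined to the rest of \<open>A\<close>, \<open>b\<close> to the rest of
  \<open>B\<close>, and the two stars are linked.\<close>

lemma connected_minus_psubset_cut_edges:
  assumes AB: "A \<union> B = V" "A \<inter> B = {}" and F: "F \<subset> cut_edges A B"
  shows "graph_connected V (nsets V 2 - F)"
proof -
  let ?R = "{(x, y). {x, y} \<in> nsets V 2 - F}"
  obtain a b where ab: "a \<in> A" "b \<in> B" "{a, b} \<notin> F"
    using F by (auto simp: cut_edges_def)
  have R: "(x, y) \<in> ?R" if "x \<in> V" "y \<in> V" "x \<noteq> y" "{x, y} \<notin> cut_edges A B" for x y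
    using that F by (auto simp: pair_in_nsets_2_iff)
  have "(a, b) \<in> ?R"
    using ab AB by (auto simp: pair_in_nsets_2_iff)
  moreover have "(a, x) \<in> ?R" if "x \<in> A" "x \<noteq> a" for x
    using that ab AB by (intro R) (auto simp: cut_edges_def doubleton_eq_iff)
  moreover have "(b, x) \<in> ?R" if "x \<in> B" "x \<noteq> b" for x
    using that ab AB by (intro R) (auto simp: cut_edges_def doubleton_eq_iff)
  ultimately have a: "(a, x) \<in> ?R\<^sup>*" if "x \<in> V" for x
    using that unfolding AB(1)[symmetric] by (blast intro: rtrancl_trans r_into_rtrancl)
  have "sym (?R\<^sup>*)"
    by (intro sym_rtrancl) (auto simp: sym_def insert_commute)
  with a have "(x, y) \<in> ?R\<^sup>*" if "x \<in> V" "y \<in> V" for x y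
    using that by (meson rtrancl_trans symD)
  then show ?thesis
    by (simp add: graph_connected_def)
qed

lemma bonds_complete_graph:
  "bonds V (nsets V 2) =
    {cut_edges A B | A B. A \<union> B = V \<and> A \<inter> B = {} \<and> A \<noteq> {} \<and> B \<noteq> {}}"
proof (intro equalityI subsetI)
  fix F assume "F \<in> bonds V (nsets V 2)"
  then have nc: "\<not> graph_connected V (nsets V 2 - F)"
    and min: "\<And>F'. F' \<subset> F \<Longrightarrow> graph_connected V (nsets V 2 - F')"
    by (auto simp: bonds_def)
  let ?R = "{(x, y). {x, y} \<in> nsets V 2 - F}"
  obtain u v where uv: "u \<in> V" "v \<in> V" "(u, v) \<notin> ?R\<^sup>*"
    using nc by (auto simp: graph_connected_def)
  \<comment> \<open>The component of \<open>u\<close> after deleting \<open>F\<close>. Every edge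
    leaving it must have been deleted, so \<open>F\<close> contains the whole cut.\<close>
  define A where "A = {x \<in> V. (u, x) \<in> ?R\<^sup>*}"
  define B where "B = V - A"
  have AB: "A \<union> B = V" "A \<inter> B = {}" "A \<noteq> {}" "B \<noteq> {}"
    using uv by (auto simp: A_def B_def)
  have "cut_edges A B \<subseteq> F"
  proof
    fix e assume "e \<in> cut_edges A B"
    then obtain a b where e: "e = {a, b}" "a \<in> A" "b \<in> B"
      by (auto simp: cut_edges_def)
    then have "(u, a) \<in> ?R\<^sup>*" "(u, b) \<notin> ?R\<^sup>*"
      by (auto simp: A_def B_def)
    then have "(a, b) \<notin> ?R"
      by (meson rtrancl.rtrancl_into_rtrancl)
    moreover have "{a, b} \<in> nsets V 2"
      using e AB by (auto simp: pair_in_nsets_2_iff)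
    ultimately show "e \<in> F"
      using e by auto
  qed
  \<comment> \<open>The cut alone already disconnects, so by minimality it cannot be a proper subset
    of \<open>F\<close>.\<close>
  with min not_connected_minus_cut_edges[OF AB] have "F = cut_edges A B"
    by blast
  with AB show "F \<in> {cut_edges A B | A B. A \<union> B = V \<and> A \<inter> B = {} \<and> A \<noteq> {} \<and> B \<noteq> {}}"
    by blast
next
  fix F assume "F \<in> {cut_edges A B | A B. A \<union> B = V \<and> A \<inter> B = {} \<and> A \<noteq> {} \<and> B \<noteq> {}}"
  then obtain A B where F: "F = cut_edges A B"
    and AB: "A \<union> B = V" "A \<inter> B = {}" "A \<noteq> {}" "B \<noteq> {}"
    by blast
  have "cut_edges A B \<subseteq> nsets V 2"
    using AB by (auto simp: cut_edges_def pair_in_nsets_2_iff)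
  then show "F \<in> bonds V (nsets V 2)"
    unfolding bonds_def F
    using not_connected_minus_cut_edges[OF AB] connected_minus_psubset_cut_edges[OF AB(1,2)]
    by blast
qed

theorem proposition3p8:
  fixes n :: nat
  assumes "n \<ge> 3"
  shows "circuits TYPE('k::field) n 2 = bonds {1..n} (nsets {1..n} 2)
      \<and> circuits TYPE('k) n 2 =
      {cut_edges A B | A B. A \<union> B = {1..n} \<and> A \<inter> B = {} \<and> A \<noteq> {} \<and> B \<noteq> {}}"
  by (simp only: circuits_2_eq_bonds bonds_complete_graph)

end
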